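(* Let $P$ be a nonempty finite set of integer vectors in $\mathbb{R}^n_+$ which contains with each $u\in P$ all its integral subvectors, and let $B(P)$ be the set of vectors $u\in P$ with $u<v$ for no $v\in P$. The following conditions are equivalent: (a) $P$ is a discrete polymatroid on $[n]$; (b) if $u,v\in P$ with $|v|>|u|$, then there is an integer $i\in[n]$ such that $u+\varepsilon_i\in P$ and $u+\varepsilon_i\le u\vee v$; (c) (i) all $u\in B(P)$ have the same modulus, and (ii) if $u,v\in B(P)$ with $u(i)>v(i)$, then there exists $j$ with $u(j)<v(j)$ such that $u-\varepsilon_i+\varepsilon_j\in B(P)$.
   Context: $[n]=\{1,\dots,n\}$; $\mathbb{R}_+^n$ is the set of real vectors with nonnegative entries; $\varepsilon_1,\dots,\varepsilon_n$ are the canonical basis vectors of $\mathbb{R}^n$; $u(i)$ is the $i$th entry of $u$; the modulus of $u$ is $|u|=\sum_iu(i)$. For $u,v\in\mathbb{R}_+^n$, $u\le v$ ($u$ is a subvector of $v$) means $u(i)\le v(i)$ for all $i$; $u<v$ means $u\le v$ and $u\ne v$; $u\vee v$ is the componentwise maximum. An integral subvector of $u$ is an integer vector $v\in\mathbb{R}_+^n$ with $v\le u$. A nonempty finite set $P$ of integer vectors in $\mathbb{R}_+^n$ which contains with each $u\in P$ all its integral subvectors is called a discrete polymatroid on $[n]$ if for all $u,v\in P$ with $|v|>|u|$ there is $w\in P$ with $u<w\le u\vee v$. *)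

theory Defs
  imports "HOL-Analysis.Analysis"
begin

text \<open>
  Vectors with \<open>n\<close> entries have type \<open>real ^ 'n\<close>: the index set \<open>[n]\<close> is the (arbitrary, nonempty,
  finite) index type \<open>'n\<close>, with \<open>n = CARD('n)\<close>. The relations \<open>\<le>\<close> and \<open><\<close> are the componentwise order
  of the library, where \<open>u < v\<close> says \<open>u \<le> v\<close> and \<open>u \<noteq> v\<close> (not strict inequality in every entry);
  \<open>sup u v\<close> is the componentwise maximum, and \<open>axis i 1\<close> is the \<open>i\<close>th canonical basis vector.
\<close>

definition nonneg_integral_vectors :: "(real ^ 'n) set" where
  "nonneg_integral_vectors = {u. \<forall>i. u $ i \<ge> 0 \<and> u $ i \<in> \<int>}"

text \<open>Not the library's \<open>\<bar>u\<bar>\<close>, which on vectors is the componentwise absolute value.\<close>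

definition modulus :: "real ^ 'n \<Rightarrow> real" where
  "modulus u = (\<Sum>i\<in>UNIV. u $ i)"

definition integral_subvectors :: "real ^ 'n \<Rightarrow> (real ^ 'n) set" where
  "integral_subvectors u = {v \<in> nonneg_integral_vectors. v \<le> u}"

definition subvector_closed_family :: "(real ^ 'n) set \<Rightarrow> bool" where
  "subvector_closed_family P \<longleftrightarrow>
     P \<noteq> {} \<and> finite P \<and> P \<subseteq> nonneg_integral_vectors \<and>
     (\<forall>u\<in>P. integral_subvectors u \<subseteq> P)"

definition discrete_polymatroid :: "(real ^ 'n) set \<Rightarrow> bool" where
  "discrete_polymatroid P \<longleftrightarrow>
     subvector_closed_family P \<and>
     (\<forall>u\<in>P. \<forall>v\<in>P. modulus v > modulus u \<longrightarrow> (\<exists>w\<in>P. u < w \<and> w \<le> sup u v))"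

definition bases :: "(real ^ 'n) set \<Rightarrow> (real ^ 'n) set" where
  "bases P = {u \<in> P. \<not> (\<exists>v\<in>P. u < v)}"

end

theory Submission
  imports Defs
begin

text \<open>
  The equivalence of the augmentation axiom with its one-step form is only integrality: if \<open>u < w\<close> are
  integer vectors, some entry of \<open>w\<close> exceeds that of \<open>u\<close> by at least one, so a unit can be added to \<open>u\<close>
  without leaving the subvectors of \<open>w\<close> (\<open>discrete_polymatroid_iff_augmentation\<close>).

  One-step augmentation gives the conditions on the bases because a vector that can be augmented is not
  a base; for the exchange, one removes the unit \<open>\<epsilon>\<^sub>i\<close> from \<open>u\<close> and augments the result towards \<open>v\<close>. The
  unit that is gained cannot be at \<open>i\<close>, where \<open>u - \<epsilon>\<^sub>i\<close> already reaches \<open>v\<close>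
  (\<open>augmentation_imp_base_exchange\<close>).

  The converse, \<open>base_exchange_imp_augmentation\<close>, carries the weight. Let
  \<open>|u| < |v|\<close>, and among all pairs of bases \<open>x \<ge> u\<close> and \<open>y \<ge> v\<close>
  take one at the least distance \<open>\<Sum>\<^sub>k |x(k) - y(k)|\<close>. Exchange moves either base one step closer to the
  other, so minimality says that no such step is compatible with \<open>x \<ge> u\<close> and \<open>y \<ge> v\<close>: wherever \<open>x\<close>
  exceeds \<open>y\<close> it agrees with \<open>u\<close>, and wherever \<open>y\<close> exceeds \<open>x\<close> it agrees with \<open>v\<close>. If \<open>u\<close> could not be
  augmented towards \<open>v\<close>, then \<open>x\<close> would also agree with \<open>u\<close> wherever \<open>v\<close> exceeds \<open>u\<close>. These facts force
  \<open>x - y \<le> u - v\<close> in every entry, so \<open>|x| - |y| \<le> |u| - |v| < 0\<close>, whereas all bases have the same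
  modulus.
\<close>

section \<open>Vectors and unit steps\<close>

lemma Ints_less_imp_add_one_le:
  fixes a b :: real
  assumes "a \<in> \<int>" "b \<in> \<int>" "a < b"
  shows "a + 1 \<le> b"
  using assms by (auto elim!: Ints_cases)

lemma axis_one_nth: "axis i (1::real) $ k = (if k = i then 1 else 0)"
  by (simp add: axis_def)

lemma sup_vec_nth: "sup u v $ k = max (u $ k) (v $ k)" for u v :: "real ^ 'n"
  by (simp add: sup_vec_def sup_max)

lemma modulus_add: "modulus (u + v) = modulus u + modulus v"
  by (simp add: modulus_def sum.distrib)

lemma modulus_diff: "modulus (u - v) = modulus u - modulus v"
  by (simp add: modulus_def sum_subtractf)

lemma modulus_axis: "modulus (axis i 1) = 1"
  by (simp add: modulus_def axis_one_nth)

lemma modulus_mono: "u \<le> v \<Longrightarrow> modulus u \<le> modulus v"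
  by (simp add: modulus_def less_eq_vec_def sum_mono)

lemma modulus_strict_mono: "u < v \<Longrightarrow> modulus u < modulus v" for u v :: "real ^ 'n"
  unfolding modulus_def less_vec_def less_eq_vec_def
  by (rule sum_strict_mono_ex1) (auto simp: not_le)

lemmas modulus_simps = modulus_add modulus_diff modulus_axis

lemma nonneg_integral_add_axis:
  "u \<in> nonneg_integral_vectors \<Longrightarrow> u + axis i 1 \<in> nonneg_integral_vectors"
  by (auto simp: nonneg_integral_vectors_def axis_one_nth)

lemma nonneg_integral_diff_axis:
  assumes "u \<in> nonneg_integral_vectors" "0 < u $ i"
  shows "u - axis i 1 \<in> nonneg_integral_vectors"
  using assms Ints_less_imp_add_one_le[of 0 "u $ i"]
  by (auto simp: nonneg_integral_vectors_def axis_one_nth)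

lemma less_imp_unit_step_le:
  assumes "u \<in> nonneg_integral_vectors" "w \<in> nonneg_integral_vectors" "u $ i < w $ i" "u \<le> w"
  shows "u + axis i 1 \<le> w"
  using assms Ints_less_imp_add_one_le[of "u $ i" "w $ i"]
  by (auto simp: nonneg_integral_vectors_def axis_one_nth less_eq_vec_def)

lemma less_add_axis: "u < u + axis i 1" for u :: "real ^ 'n"
  by (auto simp: less_vec_def less_eq_vec_def axis_one_nth not_le)

section \<open>Subvector-closed families and their bases\<close>

lemma family_nonneg_integral:
  "subvector_closed_family P \<Longrightarrow> u \<in> P \<Longrightarrow> u \<in> nonneg_integral_vectors"
  by (auto simp: subvector_closed_family_def)

lemma family_subvector:
  "subvector_closed_family P \<Longrightarrow> u \<in> P \<Longrightarrow> v \<in> nonneg_integral_vectors \<Longrightarrow> v \<le> u \<Longrightarrow> v \<in> P"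
  by (auto simp: subvector_closed_family_def integral_subvectors_def)

lemma family_finite: "subvector_closed_family P \<Longrightarrow> finite P"
  by (simp add: subvector_closed_family_def)

lemma bases_subset: "u \<in> bases P \<Longrightarrow> u \<in> P"
  by (simp add: bases_def)

lemma ex_base_above:
  assumes "subvector_closed_family P" "u \<in> P"
  shows "\<exists>x\<in>bases P. u \<le> x"
proof -
  obtain x where x: "x \<in> P" "u \<le> x" "\<forall>y\<in>P. x \<le> y \<longrightarrow> x = y"
    using finite_has_maximal2[OF family_finite[OF assms(1)] assms(2)] by blast
  then have "x \<in> bases P"
    by (auto simp: bases_def)
  with x(2) show ?thesis by blast
qed

definition augmentation :: "(real ^ 'n) set \<Rightarrow> bool" where
  "augmentation P \<longleftrightarrow>
     (\<forall>u\<in>P. \<forall>v\<in>P. modulus v > modulus u \<longrightarrow>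
        (\<exists>i. u + axis i 1 \<in> P \<and> u + axis i 1 \<le> sup u v))"

definition equal_modulus :: "(real ^ 'n) set \<Rightarrow> bool" where
  "equal_modulus B \<longleftrightarrow> (\<forall>u\<in>B. \<forall>v\<in>B. modulus u = modulus v)"

definition base_exchange :: "(real ^ 'n) set \<Rightarrow> bool" where
  "base_exchange B \<longleftrightarrow>
     (\<forall>u\<in>B. \<forall>v\<in>B. \<forall>i. u $ i > v $ i \<longrightarrow>
        (\<exists>j. u $ j < v $ j \<and> u - axis i 1 + axis j 1 \<in> B))"

lemma equal_modulusD: "equal_modulus B \<Longrightarrow> u \<in> B \<Longrightarrow> v \<in> B \<Longrightarrow> modulus u = modulus v"
  unfolding equal_modulus_def by blast

lemma discrete_polymatroid_iff_augmentation:
  assumes P: "subvector_closed_family P"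
  shows "discrete_polymatroid P \<longleftrightarrow> augmentation P"
proof
  assume dp: "discrete_polymatroid P"
  show "augmentation P"
    unfolding augmentation_def
  proof (intro ballI impI)
    fix u v assume "u \<in> P" "v \<in> P" "modulus u < modulus v"
    with dp obtain w where w: "w \<in> P" "u < w" "w \<le> sup u v"
      by (auto simp: discrete_polymatroid_def)
    from \<open>u < w\<close> obtain i where i: "u $ i < w $ i"
      by (auto simp: less_vec_def less_eq_vec_def not_le)
    have u: "u \<in> nonneg_integral_vectors" and "w \<in> nonneg_integral_vectors"
      using P \<open>u \<in> P\<close> \<open>w \<in> P\<close> by (auto intro: family_nonneg_integral)
    then have le: "u + axis i 1 \<le> w"
      using i \<open>u < w\<close> by (intro less_imp_unit_step_le) auto
    then have "u + axis i 1 \<in> P"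
      using P \<open>w \<in> P\<close> u by (blast intro: family_subvector nonneg_integral_add_axis)
    with le w(3) show "\<exists>i. u + axis i 1 \<in> P \<and> u + axis i 1 \<le> sup u v"
      using order_trans by blast
  qed
next
  assume "augmentation P"
  then show "discrete_polymatroid P"
    using P unfolding discrete_polymatroid_def augmentation_def
    by (blast intro: less_add_axis)
qed

section \<open>From augmentation to exchange of bases\<close>

lemma augmentation_imp_equal_modulus:
  assumes aug: "augmentation P"
  shows "equal_modulus (bases P)"
proof -
  have "\<not> modulus u < modulus v" if "u \<in> bases P" "v \<in> bases P" for u v
  proof
    assume "modulus u < modulus v"
    with that aug obtain i where "u + axis i 1 \<in> P"
      unfolding augmentation_def by (blast dest: bases_subset)
    with \<open>u \<in> bases P\<close> less_add_axis[of u i] show False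
      by (auto simp: bases_def)
  qed
  then show ?thesis
    unfolding equal_modulus_def by (blast intro: antisym leI)
qed

text \<open>A vector of the family lies below some base, and is that base if the two moduli agree.\<close>

lemma base_if_modulus_eq:
  assumes P: "subvector_closed_family P" and eq: "equal_modulus (bases P)"
    and "u \<in> bases P" "w \<in> P" "modulus w = modulus u"
  shows "w \<in> bases P"
proof -
  obtain x where x: "x \<in> bases P" "w \<le> x"
    using ex_base_above[OF P \<open>w \<in> P\<close>] by blast
  then have "modulus x = modulus w"
    using equal_modulusD[OF eq x(1) \<open>u \<in> bases P\<close>] assms(5) by simp
  then have "\<not> w < x"
    using modulus_strict_mono[of w x] by auto
  then have "x = w"
    using x(2) by (simp add: order.order_iff_strict)
  with x show ?thesis by simp
qed

text \<open>
  Removing a unit from \<open>u\<close> at \<open>i\<close> makes \<open>v\<close> the larger vector, and the unit that augmentation then adds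
  goes to an entry where \<open>u - \<epsilon>\<^sub>i\<close> is below \<open>v\<close>, hence not to \<open>i\<close>.
\<close>

lemma augmentation_imp_base_exchange:
  assumes P: "subvector_closed_family P" and aug: "augmentation P"
  shows "base_exchange (bases P)"
  unfolding base_exchange_def
proof (intro ballI allI impI)
  fix u v i assume u: "u \<in> bases P" and v: "v \<in> bases P" and gt: "v $ i < u $ i"
  have eq: "equal_modulus (bases P)"
    using aug by (rule augmentation_imp_equal_modulus)
  have uI: "u \<in> nonneg_integral_vectors" and vI: "v \<in> nonneg_integral_vectors"
    using family_nonneg_integral[OF P] bases_subset u v by blast+
  have gt1: "v $ i + 1 \<le> u $ i"
    using uI vI gt by (intro Ints_less_imp_add_one_le) (auto simp: nonneg_integral_vectors_def)
  have "0 < u $ i"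
    using vI le_less_trans[OF _ gt] by (simp add: nonneg_integral_vectors_def)
  then have "u - axis i 1 \<in> P"
    by (intro family_subvector[OF P bases_subset[OF u]] nonneg_integral_diff_axis[OF uI])
      (simp_all add: less_eq_vec_def axis_one_nth)
  moreover have "modulus (u - axis i 1) < modulus v"
    using equal_modulusD[OF eq u v] by (simp add: modulus_simps)
  ultimately obtain j where j: "u - axis i 1 + axis j 1 \<in> P"
      "u - axis i 1 + axis j 1 \<le> sup (u - axis i 1) v"
    using aug bases_subset[OF v] unfolding augmentation_def by blast
  from j(2) have "(u - axis i 1 + axis j 1) $ j \<le> sup (u - axis i 1) v $ j"
    unfolding less_eq_vec_def by blast
  then have vj: "(u - axis i 1) $ j + 1 \<le> v $ j"
    by (auto simp: sup_vec_nth axis_one_nth le_max_iff_disj)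
  then have "j \<noteq> i"
    using gt1 gt by (auto simp: axis_one_nth)
  then have "u $ j < v $ j"
    using vj by (auto simp: axis_one_nth)
  moreover have "u - axis i 1 + axis j 1 \<in> bases P"
    using base_if_modulus_eq[OF P eq u j(1)] by (simp add: modulus_simps)
  ultimately show "\<exists>j. u $ j < v $ j \<and> u - axis i 1 + axis j 1 \<in> bases P"
    by blast
qed

section \<open>From exchange of bases to augmentation\<close>

text \<open>
  Since the entries are integers, an exchange reduces the absolute difference by one at both of the
  entries that it changes.
\<close>

lemma modulus_exchange_closer:
  assumes x: "x \<in> nonneg_integral_vectors" and y: "y \<in> nonneg_integral_vectors"
    and i: "y $ i < x $ i" and j: "x $ j < y $ j"
  shows "modulus \<bar>x - axis i 1 + axis j 1 - y\<bar> < modulus \<bar>x - y\<bar>"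
proof (rule modulus_strict_mono)
  have steps: "y $ i + 1 \<le> x $ i" "x $ j + 1 \<le> y $ j"
    using x y i j by (auto intro!: Ints_less_imp_add_one_le simp: nonneg_integral_vectors_def)
  have "j \<noteq> i" using i j by auto
  have "\<bar>x - axis i 1 + axis j 1 - y\<bar> $ k \<le> \<bar>x - y\<bar> $ k" for k
    using steps \<open>j \<noteq> i\<close> by (cases "k = i"; cases "k = j") (simp_all add: abs_vec_def axis_one_nth)
  moreover have "\<bar>x - axis i 1 + axis j 1 - y\<bar> $ i < \<bar>x - y\<bar> $ i"
    using steps \<open>j \<noteq> i\<close> by (simp add: abs_vec_def axis_one_nth)
  ultimately show "\<bar>x - axis i 1 + axis j 1 - y\<bar> < \<bar>x - y\<bar>"
    unfolding less_vec_def less_eq_vec_def by (blast dest: leD)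
qed

text \<open>
  The minimality argument for one of the two bases; by symmetry it will serve for the other one. Where
  \<open>x\<close> exceeds both \<open>u\<close> and \<open>y\<close>, there is room to exchange a unit of \<open>x\<close> for one that brings \<open>x\<close> closer
  to \<open>y\<close> while staying above \<open>u\<close>.
\<close>

lemma closest_base_le_max:
  assumes P: "subvector_closed_family P" and ex: "base_exchange (bases P)"
    and u: "u \<in> P" "u \<le> x" and x: "x \<in> bases P" and y: "y \<in> bases P"
    and closest: "\<And>z. z \<in> bases P \<Longrightarrow> u \<le> z \<Longrightarrow> modulus \<bar>x - y\<bar> \<le> modulus \<bar>z - y\<bar>"
  shows "x $ i \<le> max (u $ i) (y $ i)"
proof (rule ccontr)
  assume "\<not> x $ i \<le> max (u $ i) (y $ i)"
  then have i: "u $ i < x $ i" "y $ i < x $ i" by auto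
  have int: "u \<in> nonneg_integral_vectors" "x \<in> nonneg_integral_vectors"
      "y \<in> nonneg_integral_vectors"
    using P u x y by (auto intro: family_nonneg_integral bases_subset)
  obtain j where j: "x $ j < y $ j" "x - axis i 1 + axis j 1 \<in> bases P"
    using ex x y i(2) unfolding base_exchange_def by blast
  have "u + axis i 1 \<le> x"
    using int i(1) u(2) by (intro less_imp_unit_step_le)
  moreover have "0 \<le> axis j (1 :: real)"
    by (simp add: less_eq_vec_def axis_one_nth)
  ultimately have "u \<le> x - axis i 1 + axis j 1"
    using add_mono[of "u + axis i 1" x 0 "axis j 1"] by (simp add: algebra_simps)
  then have "modulus \<bar>x - y\<bar> \<le> modulus \<bar>x - axis i 1 + axis j 1 - y\<bar>"
    using j(2) by (intro closest)
  with modulus_exchange_closer[OF int(2,3) i(2) j(1)] show False by simp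
qed

text \<open>
  A pair of bases above \<open>u\<close> and \<open>v\<close> at the least distance turns a failure of augmentation into
  \<open>x - y \<le> u - v\<close>, which the equality of the moduli of \<open>x\<close> and \<open>y\<close> excludes.
\<close>

lemma base_exchange_imp_augmentation:
  assumes P: "subvector_closed_family P" and eq: "equal_modulus (bases P)"
    and ex: "base_exchange (bases P)"
  shows "augmentation P"
  unfolding augmentation_def
proof (intro ballI impI, rule ccontr)
  fix u v assume u: "u \<in> P" and v: "v \<in> P" and lt: "modulus u < modulus v"
    and no: "\<nexists>i. u + axis i 1 \<in> P \<and> u + axis i 1 \<le> sup u v"
  define S where "S = {x\<in>bases P. u \<le> x} \<times> {y\<in>bases P. v \<le> y}"
  define d where "d = (\<lambda>(x, y). modulus \<bar>x - y :: real ^ 'a\<bar>)"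
  have "finite (bases P)"
    using family_finite[OF P] by (rule rev_finite_subset) (auto simp: bases_def)
  then have "finite S" by (simp add: S_def)
  moreover have "S \<noteq> {}"
    using ex_base_above[OF P u] ex_base_above[OF P v] by (auto simp: S_def)
  ultimately obtain p where p: "p \<in> S" "\<And>q. q \<in> S \<Longrightarrow> d p \<le> d q"
    using ex_is_arg_min_if_finite[of S d] by (auto simp: is_arg_min_linorder)
  obtain x y where pxy: "p = (x, y)" by (cases p)
  have x: "x \<in> bases P" "u \<le> x" and y: "y \<in> bases P" "v \<le> y"
    using p(1) by (auto simp: S_def pxy)
  have closest: "modulus \<bar>x - y\<bar> \<le> modulus \<bar>x' - y'\<bar>"
    if "x' \<in> bases P" "u \<le> x'" "y' \<in> bases P" "v \<le> y'" for x' y'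
    using p(2)[of "(x', y')"] that by (auto simp: S_def d_def pxy)
  have x_le: "x $ k \<le> max (u $ k) (y $ k)" for k
    by (rule closest_base_le_max[OF P ex u x(2,1) y(1)]) (auto intro: closest y)
  have y_le: "y $ k \<le> max (v $ k) (x $ k)" for k
    by (rule closest_base_le_max[OF P ex v y(2,1) x(1)])
      (simp add: closest x abs_minus_commute[of _ x])
  \<comment> \<open>Otherwise \<open>u\<close> plus a unit at \<open>k\<close> would be a subvector of \<open>x\<close>, hence in \<open>P\<close>, and would
    augment \<open>u\<close> towards \<open>v\<close>.\<close>
  have x_eq: "x $ k = u $ k" if k: "u $ k < v $ k" for k
  proof (rule ccontr)
    assume "x $ k \<noteq> u $ k"
    with x(2) have "u $ k < x $ k" by (auto simp: less_eq_vec_def less_le)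
    have int: "u \<in> nonneg_integral_vectors" "v \<in> nonneg_integral_vectors" "x \<in> nonneg_integral_vectors"
      using P u v x by (auto intro: family_nonneg_integral bases_subset)
    have "u + axis k 1 \<le> x"
      using int x(2) \<open>u $ k < x $ k\<close> by (intro less_imp_unit_step_le)
    then have "u + axis k 1 \<in> P"
      using P bases_subset[OF x(1)] nonneg_integral_add_axis[OF int(1)] by (blast intro: family_subvector)
    moreover have "u $ k + 1 \<le> v $ k"
      using int k by (intro Ints_less_imp_add_one_le) (auto simp: nonneg_integral_vectors_def)
    then have "u + axis k 1 \<le> sup u v"
      by (auto simp: less_eq_vec_def sup_vec_nth axis_one_nth)
    ultimately show False using no by blast
  qed
  have "x $ k - y $ k \<le> u $ k - v $ k" for k
  proof -
    have "u $ k \<le> x $ k" "v $ k \<le> y $ k"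
      using x(2) y(2) by (auto simp: less_eq_vec_def)
    \<comment> \<open>If \<open>x(k) > y(k)\<close>, then \<open>x(k) = u(k)\<close>. If \<open>x(k) < y(k)\<close>, then \<open>y(k) = v(k)\<close>, which exceeds
      \<open>u(k)\<close>, so that again \<open>x(k) = u(k)\<close>. If \<open>x(k) = y(k)\<close>, then \<open>v(k) > u(k)\<close> is impossible, as it
      gives \<open>x(k) = u(k) < v(k) \<le> y(k)\<close>.\<close>
    with x_le[of k] y_le[of k] x_eq[of k] show ?thesis by linarith
  qed
  then have "modulus (x - y) \<le> modulus (u - v)"
    by (intro modulus_mono) (simp add: less_eq_vec_def)
  moreover have "modulus x = modulus y"
    using equal_modulusD[OF eq x(1) y(1)] .
  ultimately show False using lt by (simp add: modulus_diff)
qed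

section \<open>The equivalences\<close>

theorem theorem2p3:
  fixes P :: "(real ^ 'n) set"
  assumes "subvector_closed_family P"
  shows "(discrete_polymatroid P \<longleftrightarrow>
           (\<forall>u\<in>P. \<forall>v\<in>P. modulus v > modulus u \<longrightarrow>
              (\<exists>i. u + axis i 1 \<in> P \<and> u + axis i 1 \<le> sup u v)))
       \<and> (discrete_polymatroid P \<longleftrightarrow>
           (\<forall>u\<in>bases P. \<forall>v\<in>bases P. modulus u = modulus v) \<and>
           (\<forall>u\<in>bases P. \<forall>v\<in>bases P. \<forall>i. u $ i > v $ i \<longrightarrow>
              (\<exists>j. u $ j < v $ j \<and> u - axis i 1 + axis j 1 \<in> bases P)))"
proof -
  have "discrete_polymatroid P \<longleftrightarrow> equal_modulus (bases P) \<and> base_exchange (bases P)"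
    using assms discrete_polymatroid_iff_augmentation augmentation_imp_equal_modulus
      augmentation_imp_base_exchange base_exchange_imp_augmentation by blast
  with discrete_polymatroid_iff_augmentation[OF assms] show ?thesis
    unfolding augmentation_def equal_modulus_def base_exchange_def by (intro conjI)
qed

end
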